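(* The field $\mathbb{C}$ of complex numbers contains a non-Archimedean totally ordered subfield $\mathcal{R}$. Consequently, the non-zero infinitesimals in $\mathcal{R}$ are also elements of $\mathbb{C}$.
   Context: A totally ordered subfield of $\mathbb{C}$ means a subfield of $\mathbb{C}$ equipped with a total order compatible with its field operations (an ordered field). In a totally ordered field $\mathbb{K}$ put $|x|=\max\{-x,x\}$. An element $x\in\mathbb{K}$ is infinitesimal if $|x|<1/n$ for all $n\in\mathbb{N}=\{1,2,3,\dots\}$. The field $\mathbb{K}$ is Archimedean if its only infinitesimal is $0$ (equivalently, no $x\in\mathbb{K}$ satisfies $n<|x|$ for all $n\in\mathbb{N}$), and non-Archimedean otherwise. Algebraically, $\mathbb{C}$ is regarded as an algebraically closed field of characteristic zero and cardinality $\mathfrak{c}=\mathrm{card}(\mathbb{R})$ (unique up to isomorphism). *)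

theory Defs
  imports Complex_Main "HOL-Algebra.Algebraic_Closure_Type"
begin

text \<open>
  An ordered subfield of a field \<open>'a\<close> is a carrier set \<open>K\<close> together with a (non-strict) order
  relation \<open>r\<close> on \<open>K\<close>, where \<open>(x, y) \<in> r\<close> means \<open>x \<le> y\<close>; \<open>r\<close> is unrelated to any order that the
  type \<open>'a\<close> may carry. The term \<open>ring_of_type_algebra\<close> is the type \<open>'a\<close> with its own operations,
  seen as a ring record, and \<open>linear_order_on\<close> includes \<open>r \<subseteq> K \<times> K\<close>.
\<close>

definition totally_ordered_subfield :: "'a::field set \<Rightarrow> 'a rel \<Rightarrow> bool" where
  "totally_ordered_subfield K r \<longleftrightarrow>
     subfield K (ring_of_type_algebra :: 'a ring) \<and>
     linear_order_on K r \<and>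
     (\<forall>x\<in>K. \<forall>y\<in>K. \<forall>z\<in>K. (x, y) \<in> r \<longrightarrow> (x + z, y + z) \<in> r) \<and>
     (\<forall>x\<in>K. \<forall>y\<in>K. (0, x) \<in> r \<longrightarrow> (0, y) \<in> r \<longrightarrow> (0, x * y) \<in> r)"

definition less_wrt :: "'a rel \<Rightarrow> 'a \<Rightarrow> 'a \<Rightarrow> bool" where
  "less_wrt r x y \<longleftrightarrow> (x, y) \<in> r \<and> x \<noteq> y"

definition abs_wrt :: "'a::field rel \<Rightarrow> 'a \<Rightarrow> 'a" where
  "abs_wrt r x = ord.max (\<lambda>a b. (a, b) \<in> r) (- x) x"

definition infinitesimals :: "'a::field set \<Rightarrow> 'a rel \<Rightarrow> 'a set" where
  "infinitesimals K r = {x \<in> K. \<forall>n::nat. n \<ge> 1 \<longrightarrow> less_wrt r (abs_wrt r x) (1 / of_nat n)}"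

definition archimedean_subfield :: "'a::field set \<Rightarrow> 'a rel \<Rightarrow> bool" where
  "archimedean_subfield K r \<longleftrightarrow> infinitesimals K r = {0}"

end

theory Submission
  imports Defs
    "HOL-Computational_Algebra.Fraction_Field"
    "HOL-Analysis.Continuum_Not_Denumerable"
begin

text \<open>
  The field \<open>\<rat>(X)\<close>, here the fraction field of the integer polynomials, is non-Archimedean when
  ordered by the sign of the leading coefficients: \<open>X\<close> exceeds every natural number, so \<open>1/X\<close> is a
  positive infinitesimal. It therefore suffices to find a copy of this field inside \<open>\<complex>\<close>: an order
  on a field can be transported along any embedding, and the transported order has nothing to do
  with the topology or the absolute value of \<open>\<complex>\<close>.

  To embed \<open>\<rat>(X)\<close>, send \<open>X\<close> to a complex number \<open>t\<close>. This is well-defined and injective on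
  fractions as soon as no non-zero integer polynomial vanishes at \<open>t\<close>, that is, as soon as \<open>t\<close> is
  transcendental (\<open>exists_transcendental_complex\<close>); such \<open>t\<close> exist by Cantor's argument,
  since there are only countably many algebraic numbers. The image is the subfield \<open>\<rat>(t)\<close> of \<open>\<complex>\<close>.

  The argument is thus the combination of \<open>ring_embedding_eval\<close> and \<open>ring_embedding_extends_to_fract\<close>,
  which give the embedding, with \<open>totally_ordered_subfield_range\<close> and
  \<open>infinitesimal_range\<close>, which transport the order and its infinitesimals.
\<close>

section \<open>Embeddings of integral domains into fields\<close>

locale ring_embedding =
  fixes h :: "'a::idom \<Rightarrow> 'b::field"
  assumes add: "h (x + y) = h x + h y"
    and mult: "h (x * y) = h x * h y"
    and one: "h 1 = 1"
    and eq_zeroD: "h x = 0 \<Longrightarrow> x = 0"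
begin

lemma zero: "h 0 = 0"
  by (metis add add.right_neutral add_left_imp_eq)

lemma uminus: "h (- x) = - h x"
  using add[of x "- x"] zero by (simp add: eq_neg_iff_add_eq_0 add.commute)

lemma eq_zero_iff: "h x = 0 \<longleftrightarrow> x = 0"
  using eq_zeroD zero by auto

lemma eq_iff: "h x = h y \<longleftrightarrow> x = y"
  using eq_zero_iff[of "x - y"] add[of x "- y"] uminus[of y] by simp

lemma of_nat: "h (of_nat n) = of_nat n"
  by (induction n) (simp_all add: add one zero)

end

lemma ring_embedding_inverse:
  fixes h :: "'a::Fields.field \<Rightarrow> 'b::Fields.field"
  assumes "ring_embedding h"
  shows "h (inverse x) = inverse (h x)"
proof (cases "x = 0")
  case True
  then show ?thesis by (simp add: ring_embedding.zero[OF assms])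
next
  case False
  then have "h x * h (inverse x) = 1"
    by (simp add: ring_embedding.one[OF assms] flip: ring_embedding.mult[OF assms])
  then show ?thesis
    by (metis inverse_unique)
qed

text \<open>
  This is the universal property of the fraction field: \<open>a/b \<mapsto> f a / f b\<close> does not depend on the
  chosen representative, because equality of fractions is an identity between products, which \<open>f\<close>
  preserves, and the denominators \<open>f b\<close> do not vanish.
\<close>

lemma ring_embedding_extends_to_fract:
  fixes f :: "'a::idom \<Rightarrow> 'b::Fields.field"
  assumes "ring_embedding f"
  shows "\<exists>g :: 'a fract \<Rightarrow> 'b. ring_embedding g \<and> (\<forall>a. g (Fract a 1) = f a)"
proof -
  interpret f: ring_embedding f by fact
  define g :: "'a fract \<Rightarrow> 'b"
    where "g q = (THE z. \<exists>a b. b \<noteq> 0 \<and> q = Fract a b \<and> z = f a / f b)" for q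
  have g_Fract: "g (Fract a b) = f a / f b" if b: "b \<noteq> 0" for a b
    unfolding g_def
  proof (rule the_equality)
    show "\<exists>a' b'. b' \<noteq> 0 \<and> Fract a b = Fract a' b' \<and> f a / f b = f a' / f b'"
      using b by blast
  next
    fix z
    assume "\<exists>a' b'. b' \<noteq> 0 \<and> Fract a b = Fract a' b' \<and> z = f a' / f b'"
    then obtain a' b' where b': "b' \<noteq> 0" and eq: "Fract a b = Fract a' b'" and z: "z = f a' / f b'"
      by blast
    have "f (a * b') = f (a' * b)"
      using eq b b' by (simp add: eq_fract)
    then show "z = f a / f b"
      using b b' z by (simp add: f.mult f.eq_zero_iff frac_eq_eq)
  qed
  have "ring_embedding g"
  proof
    fix p q
    show "g (p + q) = g p + g q"
    proof (cases p, cases q)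
      fix a b c d
      assume "p = Fract a b" "b \<noteq> 0" "q = Fract c d" "d \<noteq> 0"
      then show ?thesis
        by (simp add: g_Fract f.add f.mult f.eq_zero_iff add_frac_eq)
    qed
    show "g (p * q) = g p * g q"
    proof (cases p, cases q)
      fix a b c d
      assume "p = Fract a b" "b \<noteq> 0" "q = Fract c d" "d \<noteq> 0"
      then show ?thesis
        by (simp add: g_Fract f.mult)
    qed
  next
    show "g 1 = 1"
      by (simp add: One_fract_def g_Fract f.one)
  next
    fix p
    assume "g p = 0"
    then show "p = 0"
      by (cases p) (auto simp: g_Fract f.eq_zero_iff fract_collapse)
  qed
  moreover have "g (Fract a 1) = f a" for a
    by (simp add: g_Fract f.one)
  ultimately show ?thesis by blast
qed

section \<open>Transport of an order along an embedding\<close>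

definition image_order :: "('a::linordered_field \<Rightarrow> 'b) \<Rightarrow> 'b rel" where
  "image_order h = {(h x, h y) | x y. x \<le> y}"

lemma image_order_iff:
  assumes "ring_embedding h"
  shows "(h x, h y) \<in> image_order h \<longleftrightarrow> x \<le> y"
  by (auto simp: image_order_def ring_embedding.eq_iff[OF assms])

lemma linear_order_on_image_order:
  assumes "ring_embedding h"
  shows "linear_order_on (range h) (image_order h)"
proof -
  note iff = image_order_iff[OF assms] and eq = ring_embedding.eq_iff[OF assms]
  have "image_order h \<subseteq> range h \<times> range h"
    by (auto simp: image_order_def)
  moreover have "refl_on (range h) (image_order h)"
    by (auto simp: refl_on_def iff)
  moreover have "trans (image_order h)"
    by (auto simp: trans_def image_order_def eq intro: order_trans)
  moreover have "antisym (image_order h)"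
    by (auto simp: antisym_def image_order_def eq)
  moreover have "total_on (range h) (image_order h)"
    by (auto simp: total_on_def iff)
  ultimately show ?thesis
    by (simp add: linear_order_on_def partial_order_on_def preorder_on_def)
qed

lemma subfield_range:
  fixes h :: "'a::Fields.field \<Rightarrow> 'b::Fields.field"
  assumes "ring_embedding h"
  shows "subfield (range h) (ring_of_type_algebra :: 'b ring)"
proof -
  interpret h: ring_embedding h by fact
  let ?R = "ring_of_type_algebra :: 'b ring"
  interpret R: Ring.field ?R by (rule field_from_type_algebra)
  have ops: "carrier ?R = UNIV" "x \<otimes>\<^bsub>?R\<^esub> y = x * y" "x \<oplus>\<^bsub>?R\<^esub> y = x + y"
    "\<one>\<^bsub>?R\<^esub> = 1" "\<zero>\<^bsub>?R\<^esub> = 0" for x y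
    by (simp_all add: ring_of_type_algebra_def)
  have neg: "\<ominus>\<^bsub>?R\<^esub> x = - x" for x
    by (rule R.minus_equality) (simp_all add: ops)
  have inv: "inv\<^bsub>?R\<^esub> x = inverse x" if "x \<noteq> 0" for x
    by (rule R.inv_unique'[symmetric]) (use that in \<open>simp_all add: ops\<close>)
  show ?thesis
  proof (rule R.subfieldI')
    show "subring (range h) ?R"
    proof (rule R.subringI)
      show "\<one>\<^bsub>?R\<^esub> \<in> range h"
        by (metis h.one ops(4) rangeI)
    qed (auto simp: ops neg simp flip: h.uminus h.mult h.add)
  next
    fix k
    assume "k \<in> range h - {\<zero>\<^bsub>?R\<^esub>}"
    then show "inv\<^bsub>?R\<^esub> k \<in> range h"
      by (auto simp: ops inv simp flip: ring_embedding_inverse[OF assms])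
  qed
qed

lemma totally_ordered_subfield_range:
  assumes "ring_embedding h"
  shows "totally_ordered_subfield (range h) (image_order h)"
proof -
  interpret h: ring_embedding h by fact
  note iff = image_order_iff[OF assms]
  have "(h x + h z, h y + h z) \<in> image_order h" if "(h x, h y) \<in> image_order h" for x y z
    using that by (simp add: iff flip: h.add)
  moreover have "(0, h x * h y) \<in> image_order h"
    if "(0, h x) \<in> image_order h" "(0, h y) \<in> image_order h" for x y
    using that iff[of 0] by (simp add: h.zero flip: h.mult)
  ultimately show ?thesis
    unfolding totally_ordered_subfield_def
    using subfield_range[OF assms] linear_order_on_image_order[OF assms] by blast
qed

text \<open>
  An embedding fixes the rationals, so the bounds \<open>1/n\<close> in the range are the images of the bounds
  \<open>1/n\<close> in the domain.
\<close>

lemma infinitesimal_range: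
  assumes "ring_embedding h" and small: "\<And>n::nat. n \<ge> 1 \<Longrightarrow> \<bar>x\<bar> < 1 / of_nat n"
  shows "h x \<in> infinitesimals (range h) (image_order h)"
proof -
  interpret h: ring_embedding h by fact
  note iff = image_order_iff[OF assms(1)]
  have abs: "abs_wrt (image_order h) (h x) = h \<bar>x\<bar>"
    by (simp add: abs_wrt_def ord.max_def iff abs_if flip: h.uminus)
  have frac: "1 / of_nat n = h (1 / of_nat n)" for n
    using ring_embedding_inverse[OF assms(1), of "of_nat n"]
    by (simp add: h.of_nat inverse_eq_divide)
  have "less_wrt (image_order h) (h \<bar>x\<bar>) (1 / of_nat n)" if "n \<ge> 1" for n
    using small[OF that] unfolding frac less_wrt_def by (simp add: iff h.eq_iff)
  then show ?thesis
    by (simp add: infinitesimals_def abs)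
qed

section \<open>Transcendental numbers\<close>

lemma countable_int_polys: "countable (UNIV :: int poly set)"
proof -
  have "inj (coeffs :: int poly \<Rightarrow> int list)"
    by (simp add: inj_on_def coeffs_eq_iff)
  then show ?thesis
    by (rule countableI')
qed

text \<open>
  Each of the countably many non-zero integer polynomials has finitely many roots.
\<close>

lemma countable_algebraic: "countable {x :: 'a::field_char_0. algebraic x}"
proof -
  have "countable (\<Union>p\<in>{p :: int poly. p \<noteq> 0}. {x :: 'a. poly (map_poly of_int p) x = 0})"
  proof (rule countable_UN)
    show "countable {p :: int poly. p \<noteq> 0}"
      using countable_int_polys by (rule countable_subset[rotated]) simp
  next
    fix p :: "int poly"
    assume "p \<in> {p. p \<noteq> 0}"
    then have "map_poly of_int p \<noteq> (0 :: 'a poly)"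
      by (simp add: map_poly_eq_0_iff)
    then show "countable {x :: 'a. poly (map_poly of_int p) x = 0}"
      by (intro countable_finite poly_roots_finite)
  qed
  moreover have "{x :: 'a. algebraic x} \<subseteq>
      (\<Union>p\<in>{p :: int poly. p \<noteq> 0}. {x. poly (map_poly of_int p) x = 0})"
    by (auto elim!: algebraicE')
  ultimately show ?thesis
    by (rule countable_subset[rotated])
qed

lemma exists_transcendental_complex: "\<exists>t :: complex. \<not> algebraic t"
proof (rule ccontr)
  assume "\<nexists>t :: complex. \<not> algebraic t"
  then have "{t :: complex. algebraic t} = UNIV" by auto
  then show False
    using countable_algebraic[where 'a = complex] uncountable_UNIV_complex by simp
qed

lemma ring_embedding_eval:
  fixes t :: "'a::field_char_0"
  assumes "\<not> algebraic t"
  shows "ring_embedding (\<lambda>p :: int poly. poly (map_poly of_int p) t)"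
proof
  fix p q :: "int poly"
  have hom_add: "map_poly of_int (p + q) = map_poly of_int p + (map_poly of_int q :: 'a poly)" for p q
    by (rule poly_eqI) (simp add: coeff_map_poly)
  have hom_mult: "map_poly of_int (p * q) = map_poly of_int p * (map_poly of_int q :: 'a poly)" for p q
    by (rule poly_eqI) (simp add: coeff_map_poly coeff_mult)
  show "poly (map_poly of_int (p + q)) t = poly (map_poly of_int p) t + poly (map_poly of_int q) t"
    by (simp add: hom_add)
  show "poly (map_poly of_int (p * q)) t = poly (map_poly of_int p) t * poly (map_poly of_int q) t"
    by (simp add: hom_mult)
  show "poly (map_poly of_int (1 :: int poly)) t = 1"
    by simp
  assume "poly (map_poly of_int p) t = 0"
  then show "p = 0"
    using assms by (metis algebraicI coeff_map_poly map_poly_eq_0_iff of_int_0 of_int_eq_0_iff Ints_of_int)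
qed

section \<open>An infinitesimal rational function\<close>

text \<open>
  The order on polynomials compares leading coefficients, so \<open>X - n\<close> is positive for every \<open>n\<close>;
  inverting \<open>n < X\<close> gives \<open>1/X < 1/n\<close>.
\<close>

lemma exists_infinitesimal_rational_function:
  "\<exists>x :: int poly fract. x \<noteq> 0 \<and> (\<forall>n::nat. n \<ge> 1 \<longrightarrow> \<bar>x\<bar> < 1 / of_nat n)"
proof -
  let ?X = "[:0, 1:] :: int poly"
  have "0 < ?X"
    by (simp add: less_poly_def pos_poly_pCons)
  have less: "of_nat n < ?X" for n
    by (simp add: less_poly_def pos_poly_pCons of_nat_poly)
  have "\<bar>Fract 1 ?X\<bar> < 1 / of_nat n" if "n \<ge> 1" for n :: nat
  proof -
    have large: "of_nat n < Fract ?X 1"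
      using less[of n] by (simp add: of_nat_fract)
    have "\<bar>Fract 1 ?X\<bar> = Fract 1 ?X"
      using \<open>0 < ?X\<close> by simp
    also have "\<dots> = inverse (Fract ?X 1)"
      by simp
    also have "\<dots> < inverse (of_nat n)"
      using large that by (intro less_imp_inverse_less) simp_all
    finally show ?thesis
      by (simp add: inverse_eq_divide)
  qed
  moreover have "Fract 1 ?X \<noteq> 0"
    by (simp add: Zero_fract_def eq_fract)
  ultimately show ?thesis by blast
qed

section \<open>Infinitesimals among the complex numbers\<close>

theorem theorem5p1:
  shows "\<exists>(R :: complex set) (r :: complex rel).
           totally_ordered_subfield R r \<and>
           \<not> archimedean_subfield R r \<and>
           infinitesimals R r - {0} \<noteq> {} \<and>
           infinitesimals R r - {0} \<subseteq> carrier (ring_of_type_algebra :: complex ring)"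
proof -
  obtain t :: complex where "\<not> algebraic t"
    using exists_transcendental_complex by blast
  then obtain h :: "int poly fract \<Rightarrow> complex" where h: "ring_embedding h"
    using ring_embedding_extends_to_fract ring_embedding_eval by blast
  obtain x :: "int poly fract" where "x \<noteq> 0" and "\<And>n::nat. n \<ge> 1 \<Longrightarrow> \<bar>x\<bar> < 1 / of_nat n"
    using exists_infinitesimal_rational_function by blast
  then have "h x \<in> infinitesimals (range h) (image_order h) - {0}"
    using infinitesimal_range[OF h] ring_embedding.eq_zero_iff[OF h] by simp
  then have "infinitesimals (range h) (image_order h) - {0} \<noteq> {}"
    by blast
  moreover from this have "\<not> archimedean_subfield (range h) (image_order h)"
    by (auto simp: archimedean_subfield_def)
  moreover have "carrier (ring_of_type_algebra :: complex ring) = UNIV"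
    by (simp add: ring_of_type_algebra_def)
  ultimately show ?thesis
    using totally_ordered_subfield_range[OF h] by blast
qed

end
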